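(* Let $v \in \mathbb{R}^n$ be a zero-mean subgaussian random variable with variance proxy $R \succeq 0$. Then for any symmetric positive definite matrix $H \in \mathbb{R}^{n\times n}$ and any vector $x \in \mathbb{R}^n$, $$\frac{1}{\sqrt{|H+R|}}\, \mathbb{E}\left[e^{\frac12 \|x+v\|^2_{(H+R)^{-1}}}\right] \le \frac{1}{\sqrt{|H|}}\, e^{\frac12 \|x\|^2_{H^{-1}}}.$$
   Context: A zero-mean random variable $w \in \mathbb{R}^n$ is subgaussian with variance proxy $Q \succeq 0$ (a symmetric positive semidefinite matrix) if $\mathbb{E}[e^{\nu^\top w}] \le e^{\frac12 \nu^\top Q \nu}$ for all $\nu \in \mathbb{R}^n$. For a symmetric positive definite $A$, $\|x\|_A^2 = x^\top A x$; $|A|$ denotes the determinant. *)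

theory Defs
  imports "HOL-Analysis.Analysis" "HOL-Probability.Probability"
begin

text \<open>Symmetric positive semidefinite / positive definite real matrices.\<close>
definition psd_mat :: "real^'n^'n \<Rightarrow> bool" where
  "psd_mat A \<longleftrightarrow> transpose A = A \<and> (\<forall>x. 0 \<le> x \<bullet> (A *v x))"

definition pd_mat :: "real^'n^'n \<Rightarrow> bool" where
  "pd_mat A \<longleftrightarrow> transpose A = A \<and> (\<forall>x. x \<noteq> 0 \<longrightarrow> 0 < x \<bullet> (A *v x))"

text \<open>Zero-mean subgaussian random vector with variance proxy Q on probability space M.
  The MGF bound includes finiteness of the MGF (integrability).\<close>
definition subgaussian :: "'a measure \<Rightarrow> ('a \<Rightarrow> real^'n) \<Rightarrow> real^'n^'n \<Rightarrow> bool" where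
  "subgaussian M w Q \<longleftrightarrow>
     prob_space M \<and> psd_mat Q \<and> w \<in> borel_measurable M \<and>
     integrable M w \<and> (\<integral>\<omega>. w \<omega> \<partial>M) = 0 \<and>
     (\<forall>\<nu>. integrable M (\<lambda>\<omega>. exp (\<nu> \<bullet> w \<omega>)) \<and>
          (\<integral>\<omega>. exp (\<nu> \<bullet> w \<omega>) \<partial>M) \<le> exp (1/2 * (\<nu> \<bullet> (Q *v \<nu>))))"

end

(* For positive definite A, completing the square gives the Gaussian identity
     \<integral> exp (\<nu>\<bullet>y - \<nu>\<bullet>A\<nu>/2) d\<nu> = (2\<pi>)^(n/2) |A|^(-1/2) exp (y\<bullet>A\<inverse>y/2).
   Applied with A = H + R and y = x + v, it writes (2\<pi>)^(n/2) times the left-hand side as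
   E \<integral> exp (\<nu>\<bullet>(x + v) - \<nu>\<bullet>(H + R)\<nu>/2) d\<nu>. By Tonelli and the subgaussian bound
   E exp (\<nu>\<bullet>v) \<le> exp (\<nu>\<bullet>R\<nu>/2) this is at most \<integral> exp (\<nu>\<bullet>x - \<nu>\<bullet>H\<nu>/2) d\<nu>, which is
   (2\<pi>)^(n/2) times the right-hand side by the same identity with A = H.
   The Gaussian integral itself is computed by symmetric Gaussian elimination: a product of
   shears, each of determinant 1 and preserving Lebesgue measure, makes the quadratic form
   diagonal, and the integral then factors into one-dimensional Gaussian integrals. *)

theory Submission
  imports Defs
begin

lemma borel_measurable_matrix_vector_mult[measurable]:
  "((*v) (M :: real^'n::finite^'m::finite)) \<in> borel_measurable borel"
  by (intro borel_measurable_continuous_onI matrix_vector_mult_linear_continuous_on)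

definition shear_mat :: "'n::finite \<Rightarrow> real^'n \<Rightarrow> real^'n^'n" where
  "shear_mat j c = (\<chi> k. if k = j then axis j 1 + c else axis k 1)"

lemma shear_mat_mult_vec: "shear_mat j c *v v = v + (c \<bullet> v) *\<^sub>R axis j 1"
  by (simp add: vec_eq_iff matrix_vector_mul_component shear_mat_def inner_add_left inner_axis')
     (simp add: axis_def inner_commute)

lemma det_shear_mat:
  fixes j :: "'n::finite"
  assumes "c $ j = 0"
  shows "det (shear_mat j c) = 1"
proof -
  have "c = (\<Sum>k\<in>UNIV - {j}. c$k *s axis k 1)"
    using assms by (subst basis_expansion[symmetric], intro sum.mono_neutral_right) auto
  also have "\<dots> \<in> vec.span {row k (mat 1 :: real^'n^'n) |k. k \<noteq> j}"
    by (intro vec.span_sum vec.span_scale vec.span_base) (auto simp: row_def mat_def axis_def vec_eq_iff)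
  finally have "det (\<chi> k. if k = j then row j (mat 1) + c else row k (mat 1)) = det (mat 1 :: real^'n^'n)"
    by (rule det_row_span)
  moreover have "shear_mat j c = (\<chi> k. if k = j then row j (mat 1) + c else row k (mat 1))"
    by (simp add: shear_mat_def row_def mat_def axis_def vec_eq_iff)
  ultimately show ?thesis by simp
qed

lemma nn_integral_lborel_split_Basis:
  fixes e :: "'a::euclidean_space" and g :: "'a \<Rightarrow> ennreal"
  assumes [measurable]: "g \<in> borel_measurable borel" and "e \<in> Basis"
  shows "(\<integral>\<^sup>+\<nu>. g \<nu> \<partial>lborel) = (\<integral>\<^sup>+x. (\<integral>\<^sup>+y. g ((\<Sum>b\<in>Basis - {e}. x b *\<^sub>R b) + y *\<^sub>R e)
    \<partial>lborel) \<partial>(\<Pi>\<^sub>M b\<in>Basis - {e}. lborel))"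
proof -
  define I where "I = Basis - {e}"
  interpret product_sigma_finite "\<lambda>_::'a. lborel :: real measure"
    by (simp add: product_sigma_finite_def sigma_finite_lborel)
  have Basis: "Basis = insert e I" "finite I" "e \<notin> I"
    using assms(2) by (auto simp: I_def)
  have "(\<integral>\<^sup>+\<nu>. g \<nu> \<partial>lborel) = (\<integral>\<^sup>+f. g (\<Sum>b\<in>insert e I. f b *\<^sub>R b) \<partial>(\<Pi>\<^sub>M b\<in>insert e I. lborel))"
    by (subst lborel_eq) (simp add: nn_integral_distr Basis(1))
  also have "\<dots> = (\<integral>\<^sup>+x. (\<integral>\<^sup>+y. g (\<Sum>b\<in>insert e I. (x(e := y)) b *\<^sub>R b) \<partial>lborel) \<partial>(\<Pi>\<^sub>M b\<in>I. lborel))"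
    using Basis by (subst product_nn_integral_insert) auto
  also have "\<dots> = (\<integral>\<^sup>+x. (\<integral>\<^sup>+y. g ((\<Sum>b\<in>I. x b *\<^sub>R b) + y *\<^sub>R e) \<partial>lborel) \<partial>(\<Pi>\<^sub>M b\<in>I. lborel))"
  proof -
    have "(\<Sum>b\<in>insert e I. (x(e := y)) b *\<^sub>R b) = (\<Sum>b\<in>I. x b *\<^sub>R b) + y *\<^sub>R e" for x y
      using Basis(2,3) by (simp add: add.commute, intro sum.cong) auto
    then show ?thesis by simp
  qed
  finally show ?thesis
    by (simp only: I_def)
qed

text \<open>With the other coordinates fixed, the shear is a translation in coordinate \<open>j\<close>
  (as \<open>c $ j = 0\<close>); Tonelli over the remaining coordinates does the rest.\<close>

lemma lborel_distr_shear_mat: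
  fixes j :: "'n::finite" and c :: "real^'n"
  assumes "c $ j = 0"
  shows "distr lborel borel ((*v) (shear_mat j c)) = lborel"
proof -
  let ?I = "Basis - {axis j 1 :: real^'n}"
  let ?z = "\<lambda>x. \<Sum>b\<in>?I. x b *\<^sub>R b"
  have c_axis: "c \<bullet> axis j 1 = 0"
    using assms by (simp add: inner_axis)
  have shear_integral: "(\<integral>\<^sup>+\<nu>. g (shear_mat j c *v \<nu>) \<partial>lborel) = (\<integral>\<^sup>+\<nu>. g \<nu> \<partial>lborel)"
    if [measurable]: "g \<in> borel_measurable borel" for g
  proof -
    have "(\<integral>\<^sup>+\<nu>. g (shear_mat j c *v \<nu>) \<partial>lborel)
        = (\<integral>\<^sup>+x. (\<integral>\<^sup>+y. g (?z x + (c \<bullet> ?z x + y) *\<^sub>R axis j 1) \<partial>lborel) \<partial>(\<Pi>\<^sub>M b\<in>?I. lborel))"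
      by (subst nn_integral_lborel_split_Basis[of _ "axis j 1"])
        (simp_all add: shear_mat_mult_vec inner_add_right c_axis algebra_simps)
    also have "\<dots> = (\<integral>\<^sup>+x. (\<integral>\<^sup>+y. g (?z x + y *\<^sub>R axis j 1) \<partial>lborel) \<partial>(\<Pi>\<^sub>M b\<in>?I. lborel))"
    proof (rule nn_integral_cong)
      fix x
      show "(\<integral>\<^sup>+y. g (?z x + (c \<bullet> ?z x + y) *\<^sub>R axis j 1) \<partial>lborel) = (\<integral>\<^sup>+y. g (?z x + y *\<^sub>R axis j 1) \<partial>lborel)"
        using nn_integral_real_affine[of "\<lambda>y. g (?z x + y *\<^sub>R axis j 1)" 1 "c \<bullet> ?z x"] by simp
    qed
    also have "\<dots> = (\<integral>\<^sup>+\<nu>. g \<nu> \<partial>lborel)"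
      by (simp add: nn_integral_lborel_split_Basis[of g "axis j 1"])
    finally show ?thesis .
  qed
  show ?thesis
  proof (rule measure_eqI)
    fix A assume "A \<in> sets (distr lborel borel ((*v) (shear_mat j c)))"
    then have [measurable]: "A \<in> sets borel" by simp
    have "emeasure (distr lborel borel ((*v) (shear_mat j c))) A
        = (\<integral>\<^sup>+\<nu>. indicator A \<nu> \<partial>distr lborel borel ((*v) (shear_mat j c)))"
      by simp
    also have "\<dots> = (\<integral>\<^sup>+\<nu>. indicator A (shear_mat j c *v \<nu>) \<partial>lborel)"
      by (rule nn_integral_distr) measurable
    also have "\<dots> = emeasure lborel A"
      by (simp add: shear_integral)
    finally show "emeasure (distr lborel borel ((*v) (shear_mat j c))) A = emeasure lborel A" .
  qed simp
qed

lemma symmetric_matrix_inner_commute: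
  fixes A :: "real^'n::finite^'n"
  assumes "transpose A = A"
  shows "x \<bullet> (A *v y) = y \<bullet> (A *v x)"
  by (metis assms dot_lmul_matrix inner_commute vector_transpose_matrix)

lemma pd_mat_congruence_pos:
  fixes A M :: "real^'n::finite^'n"
  assumes "pd_mat A" "det M \<noteq> 0" "x \<noteq> 0"
  shows "0 < (M *v x) \<bullet> (A *v (M *v x))"
proof -
  have "inj ((*v) M)"
    using assms(2) by (intro inj_matrix_vector_mult) (simp add: invertible_det_nz)
  then have "M *v x \<noteq> 0"
    using assms(3) by (metis injD matrix_vector_mult_0_right)
  then show ?thesis
    using assms(1) by (simp add: pd_mat_def)
qed

lemma distr_lborel_matrix_mult:
  fixes M N :: "real^'n::finite^'n"
  assumes "distr lborel borel ((*v) M) = lborel" "distr lborel borel ((*v) N) = lborel"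
  shows "distr lborel borel ((*v) (M ** N)) = lborel"
proof -
  have "distr lborel borel ((*v) (M ** N)) = distr (distr lborel borel ((*v) N)) borel ((*v) M)"
    by (subst distr_distr) (auto simp: comp_def matrix_vector_mul_assoc)
  then show ?thesis
    using assms by simp
qed

lemma pd_mat_volume_preserving_diagonalization:
  fixes A :: "real^'n::finite^'n"
  assumes pd: "pd_mat A"
  obtains M where "det M = 1" "distr lborel borel ((*v) M) = lborel"
    "\<And>i k. i \<noteq> k \<Longrightarrow> (M *v axis i 1) \<bullet> (A *v (M *v axis k 1)) = 0"
proof -
  have "\<exists>M. det M = 1 \<and> distr lborel borel ((*v) M) = lborel \<and>
      (\<forall>i\<in>S. \<forall>k. i \<noteq> k \<longrightarrow> (M *v axis i 1) \<bullet> (A *v (M *v axis k 1)) = 0)"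
    if "finite S" for S
    using that
  proof (induction S rule: finite_induct)
    case empty
    show ?case by (intro exI[of _ "mat 1"]) (simp add: distr_id2)
  next
    case (insert j S)
    then obtain M where M: "det M = 1" "distr lborel borel ((*v) M) = lborel"
      and orth: "\<And>i k. i \<in> S \<Longrightarrow> i \<noteq> k \<Longrightarrow> (M *v axis i 1) \<bullet> (A *v (M *v axis k 1)) = 0"
      by blast
    define a where "a i k = (M *v axis i 1) \<bullet> (A *v (M *v axis k 1))" for i k
    have a_sym: "a i k = a k i" for i k
      using pd unfolding a_def pd_mat_def by (blast intro: symmetric_matrix_inner_commute)
    have a_jj: "a j j > 0"
      unfolding a_def using M(1) by (intro pd_mat_congruence_pos[OF pd]) simp_all
    \<comment> \<open>subtract from every column outside \<open>insert j S\<close> its \<open>A\<close>-projection onto column \<open>j\<close>\<close>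
    define c :: "real^'n" where "c = (\<chi> k. if k = j \<or> k \<in> S then 0 else - a j k / a j j)"
    define M' where "M' = M ** shear_mat j c"
    have M'_axis: "M' *v axis i 1 = M *v axis i 1 + (c$i) *\<^sub>R (M *v axis j 1)" for i
      by (simp add: M'_def matrix_vector_mul_assoc[symmetric] shear_mat_mult_vec inner_axis
          matrix_vector_right_distrib matrix_vector_mult_scaleR)
    have a': "(M' *v axis i 1) \<bullet> (A *v (M' *v axis k 1))
        = a i k + c$k * a i j + c$i * a j k + c$i * c$k * a j j" for i k
      by (simp add: M'_axis a_def matrix_vector_right_distrib matrix_vector_mult_scaleR
          inner_add_left inner_add_right algebra_simps)
    have "c $ j = 0" by (simp add: c_def)
    moreover have "(M' *v axis i 1) \<bullet> (A *v (M' *v axis k 1)) = 0"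
      if "i \<in> insert j S" "i \<noteq> k" for i k
    proof (cases "i = j")
      case True
      then show ?thesis
        using that a_jj orth[of k j] a_sym[of j k] by (auto simp: a' c_def a_def field_simps)
    next
      case False
      then show ?thesis
        using that orth[of i] by (simp add: a' c_def a_def)
    qed
    ultimately show ?case
      using M by (intro exI[of _ M']) (simp add: M'_def det_mul det_shear_mat
          distr_lborel_matrix_mult lborel_distr_shear_mat)
  qed
  from this[of UNIV] show ?thesis
    using that by auto
qed

lemma quadratic_form_diagonal:
  fixes M A :: "real^'n::finite^'n"
  assumes orth: "\<And>i k. i \<noteq> k \<Longrightarrow> (M *v axis i 1) \<bullet> (A *v (M *v axis k 1)) = 0"
  shows "(M *v \<mu>) \<bullet> (A *v (M *v \<mu>)) = (\<Sum>i\<in>UNIV. (\<mu>$i)\<^sup>2 * ((M *v axis i 1) \<bullet> (A *v (M *v axis i 1))))"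
proof -
  define u where "u i = M *v axis i 1" for i
  have M_\<mu>: "M *v \<mu> = (\<Sum>i\<in>UNIV. \<mu>$i *\<^sub>R u i)"
    by (simp add: u_def vec_eq_iff matrix_vector_mult_def sum_component axis_def if_distrib mult.commute
        cong: if_cong)
  have "(M *v \<mu>) \<bullet> (A *v (M *v \<mu>)) = (\<Sum>i\<in>UNIV. \<Sum>k\<in>UNIV. \<mu>$i * (\<mu>$k * (u k \<bullet> (A *v u i))))"
    by (simp add: M_\<mu> linear_sum[OF matrix_vector_mul_linear]
        matrix_vector_mult_scaleR inner_sum_left inner_sum_right sum_distrib_left)
  also have "\<dots> = (\<Sum>i\<in>UNIV. \<mu>$i * (\<mu>$i * (u i \<bullet> (A *v u i))))"
  proof (rule sum.cong[OF refl])
    fix i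
    show "(\<Sum>k\<in>UNIV. \<mu>$i * (\<mu>$k * (u k \<bullet> (A *v u i)))) = \<mu>$i * (\<mu>$i * (u i \<bullet> (A *v u i)))"
      by (subst sum.remove[of UNIV i]) (auto simp: orth u_def intro!: sum.neutral)
  qed
  finally show ?thesis by (simp add: u_def power2_eq_square mult.assoc)
qed

lemma matrix_congruence_entry:
  fixes M A :: "real^'n::finite^'n"
  shows "(transpose M ** A ** M) $ i $ k = (M *v axis i 1) \<bullet> (A *v (M *v axis k 1))"
proof -
  have "(transpose M ** A ** M) $ i $ k = axis i 1 \<bullet> ((transpose M ** A ** M) *v axis k 1)"
    by (simp add: inner_axis' matrix_vector_mult_basis column_def)
  also have "\<dots> = axis i 1 \<bullet> (transpose M *v (A *v (M *v axis k 1)))"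
    by (simp only: matrix_vector_mul_assoc matrix_mul_assoc)
  also have "\<dots> = (M *v axis i 1) \<bullet> (A *v (M *v axis k 1))"
    by (metis dot_lmul_matrix vector_transpose_matrix)
  finally show ?thesis .
qed

lemma det_eq_prod_congruence_diagonal:
  fixes M A :: "real^'n::finite^'n"
  assumes "det M = 1"
    and "\<And>i k. i \<noteq> k \<Longrightarrow> (M *v axis i 1) \<bullet> (A *v (M *v axis k 1)) = 0"
  shows "det A = (\<Prod>i\<in>UNIV. (M *v axis i 1) \<bullet> (A *v (M *v axis i 1)))"
proof -
  have "det A = det (transpose M ** A ** M)"
    using assms(1) by (simp add: det_mul det_transpose)
  also have "\<dots> = (\<Prod>i\<in>UNIV. (M *v axis i 1) \<bullet> (A *v (M *v axis i 1)))"
    using assms(2) by (subst det_diagonal) (simp_all add: matrix_congruence_entry)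
  finally show ?thesis .
qed

lemma pd_mat_det_pos:
  fixes A :: "real^'n::finite^'n"
  assumes "pd_mat A"
  shows "0 < det A"
proof -
  obtain M where M: "det M = 1"
    and orth: "\<And>i k. i \<noteq> k \<Longrightarrow> (M *v axis i 1) \<bullet> (A *v (M *v axis k 1)) = 0"
    using pd_mat_volume_preserving_diagonalization[OF assms] by metis
  have "0 < (\<Prod>i\<in>UNIV. (M *v axis i 1) \<bullet> (A *v (M *v axis i 1)))"
    using M by (intro prod_pos pd_mat_congruence_pos[OF assms]) simp_all
  then show ?thesis
    using det_eq_prod_congruence_diagonal[OF M orth] by simp
qed

lemma pd_mat_right_inverse:
  fixes A :: "real^'n::finite^'n"
  assumes "pd_mat A"
  shows "A ** matrix_inv A = mat 1"
proof -
  have "invertible A"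
    using pd_mat_det_pos[OF assms] by (simp add: invertible_det_nz)
  then show ?thesis
    unfolding invertible_def matrix_inv_def by (rule someI2_ex) blast
qed

lemma pd_mat_add_psd_mat:
  fixes H R :: "real^'n::finite^'n"
  assumes "pd_mat H" "psd_mat R"
  shows "pd_mat (H + R)"
  using assms unfolding pd_mat_def psd_mat_def
  by (simp add: transpose_def vec_eq_iff matrix_vector_mult_add_rdistrib inner_add_right
      add_pos_nonneg)

lemma prod_Basis_vec:
  "(\<Prod>b\<in>(Basis :: (real^'n::finite) set). f b) = (\<Prod>i\<in>UNIV. f (axis i 1))"
proof -
  have Basis_eq: "(Basis :: (real^'n) set) = (\<lambda>i. axis i 1) ` UNIV"
    by (auto simp: Basis_vec_def)
  have "inj (\<lambda>i::'n. axis i (1::real))"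
    by (auto simp: inj_on_def axis_eq_axis)
  then show ?thesis
    by (subst Basis_eq) (simp add: prod.reindex)
qed

lemma real_sqrt_prod: "sqrt (prod f A) = (\<Prod>i\<in>A. sqrt (f i))"
  by (induction A rule: infinite_finite_induct) (auto simp: real_sqrt_mult)

lemma nn_integral_gaussian_1d:
  fixes d :: real
  assumes "0 < d"
  shows "(\<integral>\<^sup>+t. ennreal (exp (- (d * t\<^sup>2) / 2)) \<partial>lborel) = ennreal (sqrt (2 * pi / d))"
proof -
  define \<sigma> where "\<sigma> = 1 / sqrt d"
  have \<sigma>: "0 < \<sigma>" "\<sigma>\<^sup>2 = 1 / d"
    using assms by (simp_all add: \<sigma>_def power_divide)
  have "exp (- (d * t\<^sup>2) / 2) = sqrt (2 * pi / d) * normal_density 0 \<sigma> t" for t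
    using assms by (simp add: normal_density_def \<sigma> real_sqrt_divide real_sqrt_mult field_simps)
  then have "(\<integral>\<^sup>+t. ennreal (exp (- (d * t\<^sup>2) / 2)) \<partial>lborel)
      = ennreal (sqrt (2 * pi / d)) * (\<integral>\<^sup>+t. ennreal (normal_density 0 \<sigma> t) \<partial>lborel)"
    using assms by (simp add: ennreal_mult nn_integral_cmult[symmetric])
  also have "(\<integral>\<^sup>+t. ennreal (normal_density 0 \<sigma> t) \<partial>lborel) = 1"
    using \<sigma>(1) by (subst nn_integral_eq_integral)
      (auto simp: integrable_normal_density integral_normal_density)
  finally show ?thesis by simp
qed

lemma nn_integral_gaussian:
  fixes A :: "real^'n::finite^'n"
  assumes pd: "pd_mat A"
  shows "(\<integral>\<^sup>+\<nu>. ennreal (exp (- (\<nu> \<bullet> (A *v \<nu>)) / 2)) \<partial>lborel)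
    = ennreal (sqrt (2 * pi) ^ CARD('n) / sqrt (det A))"
proof -
  obtain M where M: "det M = 1" "distr lborel borel ((*v) M) = lborel"
    and orth: "\<And>i k. i \<noteq> k \<Longrightarrow> (M *v axis i 1) \<bullet> (A *v (M *v axis k 1)) = 0"
    using pd_mat_volume_preserving_diagonalization[OF pd] by metis
  define d where "d b = (M *v b) \<bullet> (A *v (M *v b))" for b
  have d_pos: "0 < d b" if "b \<noteq> 0" for b
    unfolding d_def using M(1) that by (intro pd_mat_congruence_pos[OF pd]) simp_all
  have "(\<integral>\<^sup>+\<nu>. ennreal (exp (- (\<nu> \<bullet> (A *v \<nu>)) / 2)) \<partial>lborel)
      = (\<integral>\<^sup>+\<mu>. ennreal (exp (- ((M *v \<mu>) \<bullet> (A *v (M *v \<mu>))) / 2)) \<partial>lborel)"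
    by (subst (1) M(2)[symmetric]) (simp add: nn_integral_distr)
  also have "\<dots> = (\<integral>\<^sup>+\<mu>. (\<Prod>b\<in>Basis. ennreal (exp (- (d b * (\<mu> \<bullet> b)\<^sup>2) / 2))) \<partial>lborel)"
  proof (rule nn_integral_cong)
    fix \<mu> :: "real^'n"
    have "- ((M *v \<mu>) \<bullet> (A *v (M *v \<mu>))) / 2 = (\<Sum>i\<in>UNIV. - (d (axis i 1) * (\<mu>$i)\<^sup>2) / 2)"
      by (simp add: quadratic_form_diagonal[OF orth, of \<mu>] d_def sum_divide_distrib[symmetric]
          sum_negf mult.commute)
    then show "ennreal (exp (- ((M *v \<mu>) \<bullet> (A *v (M *v \<mu>))) / 2))
        = (\<Prod>b\<in>Basis. ennreal (exp (- (d b * (\<mu> \<bullet> b)\<^sup>2) / 2)))"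
      by (simp add: exp_sum prod_ennreal prod_Basis_vec inner_axis)
  qed
  also have "\<dots> = (\<Prod>b\<in>Basis. \<integral>\<^sup>+t. ennreal (exp (- (d b * t\<^sup>2) / 2)) \<partial>lborel)"
    by (rule nn_integral_lborel_prod) auto
  also have "\<dots> = (\<Prod>b\<in>Basis. ennreal (sqrt (2 * pi / d b)))"
    by (rule prod.cong[OF refl], rule nn_integral_gaussian_1d, rule d_pos) (simp add: nonzero_Basis)
  also have "\<dots> = ennreal (\<Prod>i\<in>UNIV. sqrt (2 * pi) / sqrt (d (axis i 1)))"
    using d_pos[of "axis _ 1"] by (simp add: prod_Basis_vec prod_ennreal real_sqrt_divide less_imp_le)
  also have "(\<Prod>i\<in>UNIV. sqrt (2 * pi) / sqrt (d (axis i 1))) = sqrt (2 * pi) ^ CARD('n) / sqrt (det A)"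
    by (simp add: det_eq_prod_congruence_diagonal[OF M(1) orth] d_def prod_dividef real_sqrt_prod)
  finally show ?thesis .
qed

lemma nn_integral_gaussian_linear:
  fixes A :: "real^'n::finite^'n"
  assumes pd: "pd_mat A"
  shows "(\<integral>\<^sup>+\<nu>. ennreal (exp (\<nu> \<bullet> y - \<nu> \<bullet> (A *v \<nu>) / 2)) \<partial>lborel)
    = ennreal (sqrt (2 * pi) ^ CARD('n)) * ennreal (1 / sqrt (det A) * exp (1/2 * (y \<bullet> (matrix_inv A *v y))))"
proof -
  define m where "m = matrix_inv A *v y"
  have A_m: "A *v m = y"
    by (simp add: m_def matrix_vector_mul_assoc pd_mat_right_inverse[OF pd])
  have square: "(\<nu> - m) \<bullet> (A *v (\<nu> - m)) = \<nu> \<bullet> (A *v \<nu>) - 2 * (\<nu> \<bullet> y) + y \<bullet> m" for \<nu>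
    using pd symmetric_matrix_inner_commute[of A m \<nu>]
    by (simp add: pd_mat_def matrix_vector_mult_diff_distrib inner_diff_left inner_diff_right A_m
        inner_commute[of m y] algebra_simps)
  have complete_square:
    "\<nu> \<bullet> y - \<nu> \<bullet> (A *v \<nu>) / 2 = 1/2 * (y \<bullet> m) - (\<nu> - m) \<bullet> (A *v (\<nu> - m)) / 2" for \<nu>
    unfolding square[of \<nu>] by (simp add: field_simps)
  define g where "g \<nu> = ennreal (exp (- (\<nu> \<bullet> (A *v \<nu>)) / 2))" for \<nu>
  have "(\<integral>\<^sup>+\<nu>. ennreal (exp (\<nu> \<bullet> y - \<nu> \<bullet> (A *v \<nu>) / 2)) \<partial>lborel)
      = (\<integral>\<^sup>+\<nu>. ennreal (exp (1/2 * (y \<bullet> m))) * g (- m + \<nu>) \<partial>lborel)"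
    unfolding complete_square g_def by (simp add: ennreal_mult'[symmetric] exp_add[symmetric])
  also have "\<dots> = ennreal (exp (1/2 * (y \<bullet> m))) * (\<integral>\<^sup>+\<nu>. g \<nu> \<partial>distr lborel borel ((+) (- m)))"
    unfolding g_def by (subst nn_integral_distr) (simp_all add: nn_integral_cmult)
  also have "\<dots> = ennreal (exp (1/2 * (y \<bullet> m))) * ennreal (sqrt (2 * pi) ^ CARD('n) / sqrt (det A))"
    unfolding lborel_distr_plus g_def nn_integral_gaussian[OF pd] ..
  also have "\<dots> = ennreal (sqrt (2 * pi) ^ CARD('n)) * ennreal (1 / sqrt (det A) * exp (1/2 * (y \<bullet> m)))"
    using pd_mat_det_pos[OF pd] by (simp add: ennreal_mult'[symmetric] mult.commute)
  finally show ?thesis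
    by (simp only: m_def)
qed

lemma subgaussian_nn_integral_exp_le:
  assumes "subgaussian M v R"
  shows "(\<integral>\<^sup>+\<omega>. ennreal (exp (\<nu> \<bullet> v \<omega>)) \<partial>M) \<le> ennreal (exp (1/2 * (\<nu> \<bullet> (R *v \<nu>))))"
  using assms unfolding subgaussian_def by (subst nn_integral_eq_integral) (auto intro: ennreal_leI)

lemma nn_integral_subgaussian_exp_linear_le:
  fixes H R :: "real^'n::finite^'n"
  assumes sg: "subgaussian M v R"
  shows "(\<integral>\<^sup>+\<omega>. (\<integral>\<^sup>+\<nu>. ennreal (exp (\<nu> \<bullet> (x + v \<omega>) - \<nu> \<bullet> ((H + R) *v \<nu>) / 2)) \<partial>lborel) \<partial>M)
    \<le> (\<integral>\<^sup>+\<nu>. ennreal (exp (\<nu> \<bullet> x - \<nu> \<bullet> (H *v \<nu>) / 2)) \<partial>lborel)"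
proof -
  interpret prob_space M
    using sg by (simp add: subgaussian_def)
  interpret pair_sigma_finite M lborel
    by (simp add: pair_sigma_finite_def sigma_finite_measure_axioms lborel.sigma_finite_measure_axioms)
  have [measurable]: "v \<in> borel_measurable M"
    using sg by (simp add: subgaussian_def)
  have "(\<integral>\<^sup>+\<omega>. (\<integral>\<^sup>+\<nu>. ennreal (exp (\<nu> \<bullet> (x + v \<omega>) - \<nu> \<bullet> ((H + R) *v \<nu>) / 2)) \<partial>lborel) \<partial>M)
      = (\<integral>\<^sup>+\<nu>. (\<integral>\<^sup>+\<omega>. ennreal (exp (\<nu> \<bullet> x - \<nu> \<bullet> ((H + R) *v \<nu>) / 2)) * ennreal (exp (\<nu> \<bullet> v \<omega>)) \<partial>M) \<partial>lborel)"
    by (subst Fubini') (simp_all add: ennreal_mult'[symmetric] exp_add[symmetric] inner_add_right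
        algebra_simps)
  also have "\<dots> = (\<integral>\<^sup>+\<nu>. ennreal (exp (\<nu> \<bullet> x - \<nu> \<bullet> ((H + R) *v \<nu>) / 2)) * (\<integral>\<^sup>+\<omega>. ennreal (exp (\<nu> \<bullet> v \<omega>)) \<partial>M) \<partial>lborel)"
    by (simp add: nn_integral_cmult)
  also have "\<dots> \<le> (\<integral>\<^sup>+\<nu>. ennreal (exp (\<nu> \<bullet> x - \<nu> \<bullet> ((H + R) *v \<nu>) / 2)) * ennreal (exp (1/2 * (\<nu> \<bullet> (R *v \<nu>)))) \<partial>lborel)"
    by (intro nn_integral_mono mult_left_mono subgaussian_nn_integral_exp_le[OF sg]) simp
  also have "\<dots> = (\<integral>\<^sup>+\<nu>. ennreal (exp (\<nu> \<bullet> x - \<nu> \<bullet> (H *v \<nu>) / 2)) \<partial>lborel)"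
    by (simp add: ennreal_mult'[symmetric] exp_add[symmetric] matrix_vector_mult_add_rdistrib
        inner_add_right field_simps)
  finally show ?thesis .
qed

lemma nn_integral_nn_integral_gaussian_linear:
  fixes A :: "real^'n::finite^'n" and w :: "'a \<Rightarrow> real^'n"
  assumes pd: "pd_mat A" and [measurable]: "w \<in> borel_measurable M"
  shows "(\<integral>\<^sup>+\<omega>. (\<integral>\<^sup>+\<nu>. ennreal (exp (\<nu> \<bullet> w \<omega> - \<nu> \<bullet> (A *v \<nu>) / 2)) \<partial>lborel) \<partial>M)
    = ennreal (sqrt (2 * pi) ^ CARD('n)) * (ennreal (1 / sqrt (det A)) *
        (\<integral>\<^sup>+\<omega>. ennreal (exp (1/2 * (w \<omega> \<bullet> (matrix_inv A *v w \<omega>)))) \<partial>M))"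
proof -
  have "ennreal (1 / sqrt (det A) * t) = ennreal (1 / sqrt (det A)) * ennreal t" for t
    using pd_mat_det_pos[OF pd] by (intro ennreal_mult') simp
  then have "(\<integral>\<^sup>+\<omega>. (\<integral>\<^sup>+\<nu>. ennreal (exp (\<nu> \<bullet> w \<omega> - \<nu> \<bullet> (A *v \<nu>) / 2)) \<partial>lborel) \<partial>M)
      = (\<integral>\<^sup>+\<omega>. ennreal (sqrt (2 * pi) ^ CARD('n)) * (ennreal (1 / sqrt (det A)) *
          ennreal (exp (1/2 * (w \<omega> \<bullet> (matrix_inv A *v w \<omega>))))) \<partial>M)"
    by (simp only: nn_integral_gaussian_linear[OF pd])
  then show ?thesis
    by (simp add: nn_integral_cmult)
qed

theorem lemma1:
  fixes M :: "'a measure" and v :: "'a \<Rightarrow> real^'n"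
    and R H :: "real^'n^'n" and x :: "real^'n"
  assumes "subgaussian M v R"
    and "pd_mat H"
  shows "ennreal (1 / sqrt (det (H + R))) *
           (\<integral>\<^sup>+\<omega>. ennreal (exp (1/2 * ((x + v \<omega>) \<bullet> (matrix_inv (H + R) *v (x + v \<omega>))))) \<partial>M)
         \<le> ennreal (1 / sqrt (det H) * exp (1/2 * (x \<bullet> (matrix_inv H *v x))))"
proof -
  have pd: "pd_mat (H + R)"
    using assms by (intro pd_mat_add_psd_mat) (simp_all add: subgaussian_def)
  have [measurable]: "v \<in> borel_measurable M"
    using assms(1) by (simp add: subgaussian_def)
  define K where "K = sqrt (2 * pi) ^ CARD('n)"
  have "ennreal K * (ennreal (1 / sqrt (det (H + R))) *
           (\<integral>\<^sup>+\<omega>. ennreal (exp (1/2 * ((x + v \<omega>) \<bullet> (matrix_inv (H + R) *v (x + v \<omega>))))) \<partial>M))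
      = (\<integral>\<^sup>+\<omega>. (\<integral>\<^sup>+\<nu>. ennreal (exp (\<nu> \<bullet> (x + v \<omega>) - \<nu> \<bullet> ((H + R) *v \<nu>) / 2)) \<partial>lborel) \<partial>M)"
    unfolding K_def by (rule nn_integral_nn_integral_gaussian_linear[OF pd, symmetric]) measurable
  also have "\<dots> \<le> (\<integral>\<^sup>+\<nu>. ennreal (exp (\<nu> \<bullet> x - \<nu> \<bullet> (H *v \<nu>) / 2)) \<partial>lborel)"
    by (rule nn_integral_subgaussian_exp_linear_le[OF assms(1)])
  also have "\<dots> = ennreal K * ennreal (1 / sqrt (det H) * exp (1/2 * (x \<bullet> (matrix_inv H *v x))))"
    unfolding K_def by (rule nn_integral_gaussian_linear[OF assms(2)])
  finally show ?thesis
    by (simp add: K_def ennreal_mult_le_mult_iff)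
qed

end
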